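(* Let $D$ be a connected highly-arc-transitive digraph with exactly two ends. Then there is a directed line $L$ in $D$ such that $D$ is the subdigraph induced on $\mathrm{desc}(L)=\bigcup_{v\in L}\mathrm{desc}(v)$, i.e. every vertex of $D$ is a descendant of some vertex of $L$.
   Context: Digraphs have no loops. An $s$-arc ($s\ge0$) from $u$ to $v$ is a sequence $u_0\dots u_s$ with $u_0=u$, $u_s=v$, $(u_i,u_{i+1})$ edges, and $u_{i-1}\ne u_{i+1}$ for $0<i<s$; $\mathrm{desc}(u)$ is the set of vertices reachable from $u$ by some $s$-arc. $D$ is highly-arc-transitive if for every $s\ge0$, $\mathrm{Aut}(D)$ is transitive on the set of $s$-arcs. A directed line is a sequence $(v_i)_{i\in\mathbb{Z}}$ of vertices with $(v_i,v_{i+1})$ an edge for all $i$. The ends of $D$ are the ends of its underlying undirected graph: two one-way infinite paths (rays) are equivalent if there are infinitely many pairwise disjoint finite paths joining them, and ends are the equivalence classes of rays. *)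

theory Defs
  imports "Graph_Theory.Graph_Theory"
begin

text \<open>A digraph is a \<open>pair_pre_digraph\<close> satisfying \<open>pair_loopfree_digraph\<close>: no loops and no parallel
  arcs, but possibly infinite, and \<open>(u, v)\<close> and \<open>(v, u)\<close> may both be edges.\<close>

definition s_arc :: "'a pair_pre_digraph \<Rightarrow> nat \<Rightarrow> 'a list \<Rightarrow> bool" where
  "s_arc D s us \<longleftrightarrow>
     length us = s + 1 \<and> set us \<subseteq> pverts D \<and>
     (\<forall>i<s. (us ! i, us ! (i + 1)) \<in> parcs D) \<and>
     (\<forall>i. 0 < i \<and> i < s \<longrightarrow> us ! (i - 1) \<noteq> us ! (i + 1))"

definition desc :: "'a pair_pre_digraph \<Rightarrow> 'a \<Rightarrow> 'a set" where
  "desc D u = {v. \<exists>s us. s_arc D s us \<and> us ! 0 = u \<and> us ! s = v}"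

definition automorphism :: "'a pair_pre_digraph \<Rightarrow> ('a \<Rightarrow> 'a) \<Rightarrow> bool" where
  "automorphism D f \<longleftrightarrow>
     bij_betw f (pverts D) (pverts D) \<and>
     (\<forall>u\<in>pverts D. \<forall>v\<in>pverts D. (u, v) \<in> parcs D \<longleftrightarrow> (f u, f v) \<in> parcs D)"

definition highly_arc_transitive :: "'a pair_pre_digraph \<Rightarrow> bool" where
  "highly_arc_transitive D \<longleftrightarrow>
     (\<forall>s us vs. s_arc D s us \<and> s_arc D s vs \<longrightarrow> (\<exists>f. automorphism D f \<and> map f us = vs))"

definition directed_line :: "'a pair_pre_digraph \<Rightarrow> (int \<Rightarrow> 'a) \<Rightarrow> bool" where
  "directed_line D L \<longleftrightarrow> (\<forall>i. (L i, L (i + 1)) \<in> parcs D)"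

definition desc_line :: "'a pair_pre_digraph \<Rightarrow> (int \<Rightarrow> 'a) \<Rightarrow> 'a set" where
  "desc_line D L = (\<Union>v\<in>range L. desc D v)"

definition ray :: "'a pair_pre_digraph \<Rightarrow> (nat \<Rightarrow> 'a) \<Rightarrow> bool" where
  "ray D r \<longleftrightarrow> inj r \<and> (\<forall>i. (r i, r (Suc i)) \<in> parcs (mk_symmetric D))"

text \<open>One-vertex paths are allowed as joining paths, so that two rays with infinitely many
  common vertices (in particular a ray and itself) are equivalent.\<close>

definition ray_equiv :: "'a pair_pre_digraph \<Rightarrow> ((nat \<Rightarrow> 'a) \<times> (nat \<Rightarrow> 'a)) set" where
  "ray_equiv D = {(r, r'). ray D r \<and> ray D r' \<and>
     (\<exists>P. infinite P \<and>
          (\<forall>p\<in>P. vpath p (mk_symmetric D) \<and> hd p \<in> range r \<and> last p \<in> range r') \<and>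
          pairwise (\<lambda>p q. disjnt (set p) (set q)) P)}"

definition ends :: "'a pair_pre_digraph \<Rightarrow> (nat \<Rightarrow> 'a) set set" where
  "ends D = {r. ray D r} // ray_equiv D"

lemma automorphism_iff_digraph_isomorphism:
  assumes "pair_wf_digraph D"
  shows "automorphism D f \<longleftrightarrow>
    (\<exists>hom. pre_digraph.digraph_isomorphism (with_proj D) hom \<and>
       app_iso hom (with_proj D) = with_proj D \<and> iso_verts hom = f)"
proof
  interpret pair_wf_digraph D by fact
  assume A: "automorphism D f"
  then have inj: "inj_on f (pverts D)" and img: "f ` pverts D = pverts D"
    and E: "\<And>u v. u \<in> pverts D \<Longrightarrow> v \<in> pverts D \<Longrightarrow> (u, v) \<in> parcs D \<longleftrightarrow> (f u, f v) \<in> parcs D"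
    by (auto simp: automorphism_def bij_betw_def)
  let ?h = "\<lparr>iso_verts = f, iso_arcs = map_prod f f, iso_head = snd, iso_tail = fst\<rparr>"
  have wf: "wf_digraph (with_proj D)" by (rule wf_digraph)
  have "map_prod f f ` parcs D = parcs D"
  proof (intro equalityI subsetI)
    fix e assume "e \<in> map_prod f f ` parcs D"
    then obtain u v where "(u, v) \<in> parcs D" "e = (f u, f v)" by auto
    then show "e \<in> parcs D" using E[of u v] in_arcsD1[of u v] in_arcsD2[of u v] by simp
  next
    fix e assume e: "e \<in> parcs D"
    obtain a b where ab: "e = (a, b)" by (cases e)
    with e have "a \<in> f ` pverts D" "b \<in> f ` pverts D" using in_arcsD1 in_arcsD2 img by auto
    then obtain u v where "u \<in> pverts D" "v \<in> pverts D" "a = f u" "b = f v" by auto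
    with e ab E[of u v] show "e \<in> map_prod f f ` parcs D" by (intro image_eqI[of _ _ "(u, v)"]) auto
  qed
  moreover have "inj_on (map_prod f f) (parcs D)"
    by (rule inj_on_subset[OF map_prod_inj_on[OF inj inj]]) (auto dest: in_arcsD1 in_arcsD2)
  ultimately have "pre_digraph.digraph_isomorphism (with_proj D) ?h \<and>
      app_iso ?h (with_proj D) = with_proj D \<and> iso_verts ?h = f"
    using wf inj img by (auto simp: pre_digraph.digraph_isomorphism_def app_iso_def with_proj_def)
  then show "\<exists>hom. pre_digraph.digraph_isomorphism (with_proj D) hom \<and>
       app_iso hom (with_proj D) = with_proj D \<and> iso_verts hom = f" by blast
next
  interpret pair_wf_digraph D by fact
  assume "\<exists>hom. pre_digraph.digraph_isomorphism (with_proj D) hom \<and>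
       app_iso hom (with_proj D) = with_proj D \<and> iso_verts hom = f"
  then obtain hom where h: "pre_digraph.digraph_isomorphism (with_proj D) hom"
    "app_iso hom (with_proj D) = with_proj D" "iso_verts hom = f" by blast
  from h have inj: "inj_on f (pverts D)"
    and a: "\<And>e. e \<in> parcs D \<Longrightarrow>
      f (fst e) = iso_tail hom (iso_arcs hom e) \<and> f (snd e) = iso_head hom (iso_arcs hom e)"
    by (auto simp: pre_digraph.digraph_isomorphism_def)
  from h have eqs: "f ` pverts D = pverts D" "iso_arcs hom ` parcs D = parcs D"
    "iso_tail hom = fst" "iso_head hom = snd"
    by (auto simp: app_iso_def with_proj_def)
  have m: "iso_arcs hom e = map_prod f f e" if "e \<in> parcs D" for e
    using a[OF that] eqs(3,4) by (intro prod_eqI) simp_all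
  have "(u, v) \<in> parcs D \<longleftrightarrow> (f u, f v) \<in> parcs D" if uv: "u \<in> pverts D" "v \<in> pverts D" for u v
  proof
    assume "(u, v) \<in> parcs D"
    then show "(f u, f v) \<in> parcs D" using m[of "(u, v)"] eqs(2) by force
  next
    assume "(f u, f v) \<in> parcs D"
    then obtain a b where ab: "(a, b) \<in> parcs D" "iso_arcs hom (a, b) = (f u, f v)"
      using eqs(2) by (metis imageE surj_pair)
    then have "f a = f u" "f b = f v" using m by auto
    then have "a = u" "b = v" using inj uv ab(1) in_arcsD1 in_arcsD2 by (auto dest: inj_onD)
    with ab show "(u, v) \<in> parcs D" by simp
  qed
  with inj eqs show "automorphism D f" by (auto simp: automorphism_def bij_betw_def)
qed

lemma induce_desc_line_iff:
  assumes "pair_wf_digraph D"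
  shows "with_proj D \<restriction> desc_line D L = with_proj D \<longleftrightarrow>
    (\<forall>v\<in>pverts D. \<exists>i. v \<in> desc D (L i))"
proof -
  interpret pair_wf_digraph D by fact
  have sub: "desc_line D L \<subseteq> pverts D"
    by (auto simp: desc_line_def desc_def s_arc_def)
  have "with_proj D \<restriction> desc_line D L = with_proj D \<longleftrightarrow> desc_line D L = pverts D"
  proof
    assume "with_proj D \<restriction> desc_line D L = with_proj D"
    then show "desc_line D L = pverts D" by (metis induce_subgraph_verts with_proj_simps(1))
  next
    assume eq: "desc_line D L = pverts D"
    have "{e \<in> parcs D. fst e \<in> pverts D \<and> snd e \<in> pverts D} = parcs D"
      by (auto dest: in_arcsD1 in_arcsD2)
    then show "with_proj D \<restriction> desc_line D L = with_proj D"
      unfolding eq by (simp add: induce_subgraph_def with_proj_def)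
  qed
  also have "\<dots> \<longleftrightarrow> pverts D \<subseteq> desc_line D L" using sub by blast
  finally show ?thesis unfolding desc_line_def by blast
qed

end

theory Submission
  imports Defs
begin

text \<open>
  If \<open>D\<close> has a directed cycle, arc-transitivity puts every arc on one, so connectedness makes every
  vertex a descendant of every other. Now let \<open>D\<close> be acyclic.

  A connected vertex-transitive graph with two ends contains no infinite family of pairwise disjoint
  rays: some translate of a finite set \<open>F\<close> separating the ends would cut off more than \<open>|F|\<close> disjoint
  rays from the end they converge to. As the degree may be infinite, the translate comes from
  Neumann's separation lemma rather than from distances.

  Hence any two ancestors of a vertex have a common ancestor, since otherwise repeated splitting would give
  infinitely many disjoint sets of ancestors, each containing a ray. By connectedness
  any two vertices have a common ancestor. The vertices of a maximal (hence finite) family of disjoint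
  rays form a countable set \<open>W\<close> containing an ancestor of every vertex, and a backward path through
  common ancestors of longer and longer initial segments of \<open>W\<close> has every vertex among its
  descendants; it extends forward to the required line.
\<close>

section \<open>Disjoint rays in two-ended vertex-transitive graphs\<close>

text \<open>At each stage an index compatible with all earlier ones is chosen. Nonemptiness makes
  these indices distinct, since a nonempty set is not disjoint from itself. Sets are attached to
  indices because the result is applied to paths given as lists and to rays given as
  functions.\<close>

lemma infinite_disjoint_family:
  fixes P :: "'b set"
  assumes ext: "\<And>Q. finite Q \<Longrightarrow> Q \<subseteq> P \<Longrightarrow> \<exists>p\<in>P. \<forall>q\<in>Q. disjnt (f p) (f q)"
    and ne: "\<And>p. p \<in> P \<Longrightarrow> f p \<noteq> {}"
  shows "\<exists>Q\<subseteq>P. infinite Q \<and> pairwise (\<lambda>p q. disjnt (f p) (f q)) Q"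
proof -
  have "\<exists>h. \<forall>n::nat. h n \<in> P \<and> (\<forall>m<n. disjnt (f (h n)) (f (h m)))"
  proof (rule dependent_wellorder_choice[where
        P = "\<lambda>h n p. p \<in> P \<and> (\<forall>m<n. disjnt (f p) (f (h m)))"])
    fix n :: nat and h
    assume "\<And>m. m < n \<Longrightarrow> h m \<in> P \<and> (\<forall>l<m. disjnt (f (h m)) (f (h l)))"
    then have "h ` {..<n} \<subseteq> P" by blast
    from ext[OF _ this] show "\<exists>p. p \<in> P \<and> (\<forall>m<n. disjnt (f p) (f (h m)))" by auto
  qed simp
  then obtain h :: "nat \<Rightarrow> 'b"
    where h: "\<And>n. h n \<in> P" "\<And>m n. m < n \<Longrightarrow> disjnt (f (h n)) (f (h m))"
    by blast
  have disj: "disjnt (f (h m)) (f (h n))" if "m \<noteq> n" for m n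
    using h(2)[of m n] h(2)[of n m] that by (meson disjnt_sym nat_neq_iff)
  have "inj h"
    using disj h(1) ne by (metis disjnt_self_iff_empty injI)
  then have "infinite (range h)" by (simp add: finite_image_iff)
  moreover have "pairwise (\<lambda>p q. disjnt (f p) (f q)) (range h)"
    unfolding pairwise_def using disj by (metis rangeE)
  moreover have "range h \<subseteq> P" using h(1) by blast
  ultimately show ?thesis by (intro exI[of _ "range h"] conjI)
qed

section \<open>Rays, ends and finite separators in a connected graph\<close>

locale connected_graph =
  fixes V :: "'a set" and E :: "('a \<times> 'a) set"
  assumes edges_in: "E \<subseteq> V \<times> V"
    and sym_edges: "sym E"
    and connected: "u \<in> V \<Longrightarrow> v \<in> V \<Longrightarrow> (u, v) \<in> rtrancl_on V E"
begin

abbreviation linked :: "'a set \<Rightarrow> 'a \<Rightarrow> 'a \<Rightarrow> bool" where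
  "linked X u v \<equiv> (u, v) \<in> rtrancl_on (V - X) E"

lemma linked_sym: "linked X u v \<Longrightarrow> linked X v u"
  using rtrancl_on_sym[OF sym_edges] by (rule symD)

lemma linked_trans: "linked X u v \<Longrightarrow> linked X v w \<Longrightarrow> linked X u w"
  by (rule rtrancl_on_trans)

lemma linked_mono: "linked X u v \<Longrightarrow> Y \<subseteq> X \<Longrightarrow> linked Y u v"
  by (rule rtrancl_on_mono[OF subset_refl]) auto

lemma linked_notin: "linked X u v \<Longrightarrow> u \<in> V \<and> u \<notin> X \<and> v \<in> V \<and> v \<notin> X"
  using in_rtrancl_on_in_F by fastforce

text \<open>Every vertex on a connection from \<open>u\<close> avoiding \<open>X\<close> is itself
  linked to \<open>u\<close>, so by hypothesis it is outside \<open>Y\<close>, and the same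
  connection avoids \<open>Y\<close>. This exchanges one separator for another.\<close>

lemma linked_avoiding:
  assumes "linked X u v" and "\<And>y. y \<in> Y \<Longrightarrow> \<not> linked X u y"
  shows "linked Y u v"
  using assms(1)
proof (induct rule: rtrancl_on_induct)
  case base
  then have "linked X u u" by blast
  with base assms(2)[of u] show ?case by blast
next
  case (step b c)
  then have "linked X u c" by (blast intro: rtrancl_on_into_rtrancl_on)
  with step assms(2) show ?case by (blast intro: rtrancl_on_into_rtrancl_on)
qed

text \<open>Finite paths from one base vertex \<open>c\<close> to all points of \<open>T\<close> are
  united; any two vertices are then joined through \<open>c\<close>.\<close>

lemma finite_connected_superset:
  assumes "finite T" "T \<subseteq> V" "T \<noteq> {}"
  shows "\<exists>S. finite S \<and> T \<subseteq> S \<and> S \<subseteq> V \<and> (\<forall>u\<in>S. \<forall>v\<in>S. (u, v) \<in> rtrancl_on S E)"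
proof -
  obtain c where c: "c \<in> T" using assms by blast
  have path: "\<exists>Q. finite Q \<and> Q \<subseteq> V \<and> v \<in> Q \<and> (\<forall>x\<in>Q. (c, x) \<in> rtrancl_on Q E)"
    if "(c, v) \<in> rtrancl_on V E" for v
    using that
  proof (induct rule: rtrancl_on_induct)
    case base
    then show ?case by (intro exI[of _ "{c}"]) auto
  next
    case (step y z)
    then obtain Q where Q: "finite Q" "Q \<subseteq> V" "y \<in> Q" "\<forall>x\<in>Q. (c, x) \<in> rtrancl_on Q E" by blast
    then have *: "(c, x) \<in> rtrancl_on (insert z Q) E" if "x \<in> Q" for x
      using that by (blast intro: rtrancl_on_mono)
    with Q step have "(c, z) \<in> rtrancl_on (insert z Q) E"
      by (blast intro: rtrancl_on_into_rtrancl_on)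
    with Q step * show ?case by (intro exI[of _ "insert z Q"]) auto
  qed
  have "\<exists>Q. finite Q \<and> Q \<subseteq> V \<and> v \<in> Q \<and> (\<forall>x\<in>Q. (c, x) \<in> rtrancl_on Q E)" if "v \<in> T" for v
    using path connected c assms(2) that by blast
  then obtain Q where Q: "\<And>v. v \<in> T \<Longrightarrow> finite (Q v) \<and> Q v \<subseteq> V \<and> v \<in> Q v \<and>
      (\<forall>x\<in>Q v. (c, x) \<in> rtrancl_on (Q v) E)"
    by metis
  let ?S = "\<Union>v\<in>T. Q v"
  have reach: "(c, x) \<in> rtrancl_on ?S E" if "x \<in> ?S" for x
    using that Q by (blast intro: rtrancl_on_mono)
  have "(u, v) \<in> rtrancl_on ?S E" if "u \<in> ?S" "v \<in> ?S" for u v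
    using reach[OF that(1)] reach[OF that(2)] rtrancl_on_sym[OF sym_edges, of ?S]
    by (meson rtrancl_on_trans symD)
  then show ?thesis using Q assms(1) by (intro exI[of _ ?S]) blast
qed

definition is_ray :: "(nat \<Rightarrow> 'a) \<Rightarrow> bool" where
  "is_ray r \<longleftrightarrow> inj r \<and> (\<forall>i. (r i, r (Suc i)) \<in> E)"

text \<open>Ends are encoded by finite separators instead of disjoint joining paths, which makes
  transitivity and invariance under translation direct. The two notions are shown to agree in
  \<open>ray_equiv_iff_end_equiv\<close>.\<close>

definition end_equiv :: "(nat \<Rightarrow> 'a) \<Rightarrow> (nat \<Rightarrow> 'a) \<Rightarrow> bool" where
  "end_equiv a b \<longleftrightarrow> is_ray a \<and> is_ray b \<and>
     (\<forall>X. finite X \<longrightarrow> (\<exists>N. \<forall>i\<ge>N. \<forall>j\<ge>N. linked X (a i) (b j)))"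

lemma ray_in: "is_ray r \<Longrightarrow> r i \<in> V"
  using edges_in by (auto simp: is_ray_def)

lemma ray_segment_linked:
  assumes "is_ray r" "m \<le> n" "\<And>i. m \<le> i \<Longrightarrow> r i \<notin> X"
  shows "linked X (r m) (r n)"
  using assms(2)
proof (induct n rule: dec_induct)
  case base
  then show ?case using assms ray_in by blast
next
  case (step n)
  have "(r n, r (Suc n)) \<in> E" using assms(1) by (simp add: is_ray_def)
  moreover have "r (Suc n) \<in> V - X" using assms ray_in step by auto
  ultimately show ?case using step(3) by (blast intro: rtrancl_on_into_rtrancl_on)
qed

lemma end_equiv_refl:
  assumes "is_ray r"
  shows "end_equiv r r"
  unfolding end_equiv_def
proof (intro conjI allI impI assms)
  fix X :: "'a set" assume "finite X"
  then have "finite (r -` X)" using assms by (simp add: finite_vimageI is_ray_def)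
  then obtain N where "\<forall>i\<in>r -` X. i < N" using finite_nat_set_iff_bounded by blast
  then have N: "r i \<notin> X" if "N \<le> i" for i using that by (metis leD vimageI)
  have "linked X (r i) (r j)" if "N \<le> i" "N \<le> j" for i j
  proof (cases "i \<le> j")
    case True
    then show ?thesis using ray_segment_linked[OF assms True] N that by auto
  next
    case False
    then have "linked X (r j) (r i)" using ray_segment_linked[OF assms, of j i] N that by auto
    then show ?thesis by (rule linked_sym)
  qed
  then show "\<exists>N. \<forall>i\<ge>N. \<forall>j\<ge>N. linked X (r i) (r j)" by blast
qed

lemma end_equiv_sym: "end_equiv a b \<Longrightarrow> end_equiv b a"
  unfolding end_equiv_def using linked_sym by meson

lemma end_equiv_trans:
  assumes "end_equiv a b" "end_equiv b c"
  shows "end_equiv a c"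
  unfolding end_equiv_def
proof (intro conjI allI impI)
  fix X :: "'a set" assume X: "finite X"
  obtain M where M: "\<forall>i\<ge>M. \<forall>j\<ge>M. linked X (a i) (b j)"
    using assms(1) X unfolding end_equiv_def by blast
  obtain N where N: "\<forall>i\<ge>N. \<forall>j\<ge>N. linked X (b i) (c j)"
    using assms(2) X unfolding end_equiv_def by blast
  have "linked X (a i) (c j)" if "max M N \<le> i" "max M N \<le> j" for i j
    using M[rule_format, of i "max M N"] N[rule_format, of "max M N" j] that
    by (auto intro: linked_trans)
  then show "\<exists>N. \<forall>i\<ge>N. \<forall>j\<ge>N. linked X (a i) (c j)" by blast
qed (use assms in \<open>auto simp: end_equiv_def\<close>)

text \<open>One linked pair per finite set is enough: once \<open>X\<close> is enlarged by initial
  segments of both rays, the pair must lie in tails that are already connected outside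
  \<open>X\<close>.\<close>

lemma end_equivI:
  assumes "is_ray a" "is_ray b" and link: "\<And>X. finite X \<Longrightarrow> \<exists>i j. linked X (a i) (b j)"
  shows "end_equiv a b"
  unfolding end_equiv_def
proof (intro conjI allI impI assms)
  fix X :: "'a set" assume X: "finite X"
  obtain M where M: "\<forall>i\<ge>M. \<forall>j\<ge>M. linked X (a i) (a j)"
    using end_equiv_refl[OF assms(1)] X unfolding end_equiv_def by blast
  obtain N where N: "\<forall>i\<ge>N. \<forall>j\<ge>N. linked X (b i) (b j)"
    using end_equiv_refl[OF assms(2)] X unfolding end_equiv_def by blast
  obtain i j where ij: "linked (X \<union> a ` {..M} \<union> b ` {..N}) (a i) (b j)"
    using link[of "X \<union> a ` {..M} \<union> b ` {..N}"] X by blast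
  then have "M \<le> i" "N \<le> j" using linked_notin[OF ij] by force+
  moreover have "linked X (a i) (b j)" using ij by (rule linked_mono) auto
  ultimately have "linked X (a i') (b j')" if "max M N \<le> i'" "max M N \<le> j'" for i' j'
    using M[rule_format, of i' i] N[rule_format, of j j'] that by (auto intro: linked_trans)
  then show "\<exists>N. \<forall>i\<ge>N. \<forall>j\<ge>N. linked X (a i) (b j)" by blast
qed

definition converges_to :: "'a set \<Rightarrow> (nat \<Rightarrow> 'a) \<Rightarrow> 'a \<Rightarrow> bool" where
  "converges_to X r s \<longleftrightarrow> (\<exists>N. \<forall>i\<ge>N. linked X (r i) s)"

lemma converges_to_end_equiv:
  assumes "converges_to X a s" "end_equiv a b" "finite X"
  shows "converges_to X b s"
proof -
  obtain M where M: "\<forall>i\<ge>M. linked X (a i) s"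
    using assms(1) by (auto simp: converges_to_def)
  obtain N where N: "\<forall>i\<ge>N. \<forall>j\<ge>N. linked X (a i) (b j)"
    using assms(2,3) unfolding end_equiv_def by blast
  have "linked X (b i) s" if "max M N \<le> i" for i
    using M[rule_format, of "max M N"] N[rule_format, of "max M N" i] that
    by (auto intro: linked_trans linked_sym)
  then show ?thesis unfolding converges_to_def by blast
qed

definition disjoint_rays :: "(nat \<Rightarrow> 'a) set \<Rightarrow> bool" where
  "disjoint_rays R \<longleftrightarrow> (\<forall>r\<in>R. is_ray r) \<and> pairwise (\<lambda>r s. disjnt (range r) (range s)) R"

lemma small_set_misses_ray:
  assumes "disjoint_rays R" "finite X" "card X < card R"
  shows "\<exists>r\<in>R. range r \<inter> X = {}"
proof (rule ccontr)
  assume "\<not> ?thesis"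
  then have "\<forall>r\<in>R. \<exists>x. x \<in> range r \<inter> X" by blast
  then obtain f where f: "\<And>r. r \<in> R \<Longrightarrow> f r \<in> range r \<inter> X" by metis
  have "inj_on f R"
  proof (rule inj_onI, rule ccontr)
    fix r s assume rs: "r \<in> R" "s \<in> R" "f r = f s" "r \<noteq> s"
    then have "disjnt (range r) (range s)"
      using assms(1) by (auto simp: disjoint_rays_def pairwise_def)
    moreover have "f r \<in> range r" "f r \<in> range s" using f rs by (metis IntD1)+
    ultimately show False by (auto simp: disjnt_def)
  qed
  then have "card R \<le> card X" using f assms(2) by (intro card_inj_on_le) auto
  then show False using assms(3) by simp
qed

text \<open>By pigeonhole \<open>X\<close> misses one ray of \<open>R\<close> entirely. That ray
  stays in the component of \<open>s\<close>, and \<open>c\<close> belongs to the same end.\<close>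

lemma thick_end_not_separated:
  assumes R: "disjoint_rays R" "\<And>r. r \<in> R \<Longrightarrow> end_equiv r c" "\<And>r. r \<in> R \<Longrightarrow> linked X (r 0) s"
    and X: "finite X" "card X < card R"
  shows "converges_to X c s"
proof -
  obtain r where r: "r \<in> R" "range r \<inter> X = {}" using small_set_misses_ray[OF R(1) X] by blast
  then have "is_ray r" using R(1) by (simp add: disjoint_rays_def)
  then have "linked X (r 0) (r i)" for i using r by (intro ray_segment_linked) auto
  then have "converges_to X r s"
    unfolding converges_to_def using R(3)[OF r(1)] by (blast intro: linked_trans linked_sym)
  then show ?thesis using converges_to_end_equiv R(2) r(1) X(1) by blast
qed

text \<open>For a ray \<open>c\<close>, this says that the vertex degree of its end is greater than
  \<open>n\<close>.\<close>

definition thick :: "nat \<Rightarrow> (nat \<Rightarrow> 'a) \<Rightarrow> bool" where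
  "thick n c \<longleftrightarrow> (\<exists>R. finite R \<and> n < card R \<and> disjoint_rays R \<and> (\<forall>r\<in>R. end_equiv r c))"

lemma thick_end_equiv: "thick n c \<Longrightarrow> end_equiv c d \<Longrightarrow> thick n d"
  unfolding thick_def using end_equiv_trans by meson

end

section \<open>Translates of finite separators\<close>

locale transitive_graph = connected_graph +
  fixes G :: "('a \<Rightarrow> 'a) set"
  assumes bij: "g \<in> G \<Longrightarrow> bij_betw g V V"
    and edge_image: "g \<in> G \<Longrightarrow> (u, v) \<in> E \<Longrightarrow> (g u, g v) \<in> E"
    and comp_closed: "g \<in> G \<Longrightarrow> h \<in> G \<Longrightarrow> g \<circ> h \<in> G"
    and inv_closed: "g \<in> G \<Longrightarrow> inv_into V g \<in> G"
    and transitive: "u \<in> V \<Longrightarrow> v \<in> V \<Longrightarrow> \<exists>g\<in>G. g u = v"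
begin

lemma image_in: "g \<in> G \<Longrightarrow> x \<in> V \<Longrightarrow> g x \<in> V"
  using bij bij_betwE by blast

lemma inv_left: "g \<in> G \<Longrightarrow> x \<in> V \<Longrightarrow> inv_into V g (g x) = x"
  by (rule bij_betw_inv_into_left[OF bij])

lemma inv_right: "g \<in> G \<Longrightarrow> x \<in> V \<Longrightarrow> g (inv_into V g x) = x"
  by (rule bij_betw_inv_into_right[OF bij])

lemma eq_on: "g \<in> G \<Longrightarrow> x \<in> V \<Longrightarrow> y \<in> V \<Longrightarrow> g x = g y \<Longrightarrow> x = y"
  by (metis inv_left)

text \<open>P. M. Neumann's separation lemma. If \<open>g\<close> moves \<open>A\<close> off \<open>B\<close> but sends \<open>a\<close> to \<open>b \<in> B\<close>, then
  \<open>k\<^sub>b\<inverse> g\<close> sends \<open>a\<close> to the point \<open>c \<notin> B\<close>, and it still moves \<open>A\<close> off \<open>B\<close> if \<open>g\<close> also moved \<open>A\<close> off \<open>k\<^sub>b B\<close>.\<close>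

lemma separating_translate:
  assumes "infinite V" "finite A" "A \<subseteq> V" "finite B"
  shows "\<exists>g\<in>G. g ` A \<inter> B = {}"
  using assms(2-4)
proof (induct A arbitrary: B)
  case empty
  then show ?case using assms(1) transitive by (metis ex_in_conv finite.emptyI image_empty inf_bot_left)
next
  case (insert a A)
  obtain c where c: "c \<in> V" "c \<notin> B"
    using assms(1) insert.prems(2) by (meson finite_subset subsetI)
  obtain k where k: "\<And>b. b \<in> V \<Longrightarrow> k b \<in> G \<and> k b c = b"
    using transitive[OF c(1)] by metis
  have "finite (B \<union> (\<Union>b\<in>B. k b ` B))" using insert.prems by auto
  then obtain g where g: "g \<in> G" "g ` A \<inter> (B \<union> (\<Union>b\<in>B. k b ` B)) = {}"
    using insert.hyps(3)[of "B \<union> (\<Union>b\<in>B. k b ` B)"] insert.prems(1) by auto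
  show ?case
  proof (cases "g a \<in> B")
    case False
    then show ?thesis using g by blast
  next
    case True
    define b where "b = g a"
    have b: "b \<in> V" "b \<in> B" using True g insert.prems image_in by (auto simp: b_def)
    let ?h = "inv_into V (k b) \<circ> g"
    have "?h \<in> G" using k b g comp_closed inv_closed by blast
    moreover have "?h a = c" using k[OF b(1)] c inv_left by (metis b_def comp_apply)
    moreover have "?h x \<notin> B" if "x \<in> A" for x
    proof
      assume "?h x \<in> B"
      moreover have "k b (?h x) = g x"
        using k[OF b(1)] inv_right image_in g insert.prems that by auto
      ultimately have "g x \<in> k b ` B" by (metis imageI)
      then show False using g(2) b(2) that by blast
    qed
    ultimately show ?thesis using c by blast
  qed
qed

lemma rtrancl_on_image:
  assumes "g \<in> G" "(u, v) \<in> rtrancl_on S E"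
  shows "(g u, g v) \<in> rtrancl_on (g ` S) E"
  using assms(2)
  by (induct rule: rtrancl_on_induct) (auto intro: rtrancl_on_into_rtrancl_on edge_image[OF assms(1)])

lemma linked_image:
  assumes "g \<in> G" "X \<subseteq> V" "linked X u v"
  shows "linked (g ` X) (g u) (g v)"
proof -
  have "g ` (V - X) \<subseteq> V - g ` X" using assms image_in eq_on by blast
  then show ?thesis using rtrancl_on_image[OF assms(1,3)] by (blast intro: rtrancl_on_mono)
qed

lemma linked_image_iff:
  assumes "g \<in> G" "X \<subseteq> V" "u \<in> V" "v \<in> V"
  shows "linked (g ` X) (g u) (g v) \<longleftrightarrow> linked X u v"
proof
  assume l: "linked (g ` X) (g u) (g v)"
  have "inv_into V g ` g ` X = X" using assms inv_left by (force simp: image_image)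
  moreover have "g ` X \<subseteq> V" using assms image_in by blast
  ultimately show "linked X u v"
    using linked_image[OF inv_closed[OF assms(1)] _ l] assms inv_left by simp
qed (use assms linked_image in blast)

lemma ray_image:
  assumes "g \<in> G" "is_ray r"
  shows "is_ray (g \<circ> r)"
  using assms ray_in[OF assms(2)] eq_on[OF assms(1)] edge_image[OF assms(1)]
  by (auto simp: is_ray_def inj_on_def)

lemma end_equiv_image:
  assumes "g \<in> G" "end_equiv a b"
  shows "end_equiv (g \<circ> a) (g \<circ> b)"
proof (rule end_equivI)
  fix X :: "'a set" assume X: "finite X"
  \<comment> \<open>Only points of \<open>V\<close> can be pulled back by \<open>g\<close>; deleting
    points outside \<open>V\<close> does not change \<open>linked\<close>.\<close>
  let ?X = "inv_into V g ` (X \<inter> V)"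
  have X': "?X \<subseteq> V" using image_in[OF inv_closed[OF assms(1)]] by blast
  obtain i j where "linked ?X (a i) (b j)"
    using assms(2) X unfolding end_equiv_def by (meson finite_Int finite_imageI order_refl)
  then have "linked (g ` ?X) (g (a i)) (g (b j))" using linked_image[OF assms(1) X'] by blast
  moreover have "g ` ?X = X \<inter> V" using inv_right[OF assms(1)] by (force simp: image_image)
  ultimately have "linked X (g (a i)) (g (b j))" by (auto simp: Diff_Int)
  then show "\<exists>i j. linked X ((g \<circ> a) i) ((g \<circ> b) j)" by auto
qed (use assms ray_image in \<open>auto simp: end_equiv_def\<close>)

lemma thick_image:
  assumes "g \<in> G" "thick n c"
  shows "thick n (g \<circ> c)"
proof -
  obtain R where R: "finite R" "n < card R" "disjoint_rays R" "\<forall>r\<in>R. end_equiv r c"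
    using assms(2) unfolding thick_def by blast
  have ray: "r i \<in> V" if "r \<in> R" for r i using R(3) that ray_in by (auto simp: disjoint_rays_def)
  have "inj_on (\<lambda>r. g \<circ> r) R"
  proof (rule inj_onI)
    fix r r' assume *: "r \<in> R" "r' \<in> R" "g \<circ> r = g \<circ> r'"
    have "r i = r' i" for i using eq_on[OF assms(1) ray[OF *(1)] ray[OF *(2)]] *(3) by (metis comp_apply)
    then show "r = r'" by blast
  qed
  then have "card ((\<lambda>r. g \<circ> r) ` R) = card R" by (rule card_image)
  moreover have "disjoint_rays ((\<lambda>r. g \<circ> r) ` R)"
    unfolding disjoint_rays_def
  proof (intro conjI ballI pairwiseI)
    fix p q assume "p \<in> (\<lambda>r. g \<circ> r) ` R" "q \<in> (\<lambda>r. g \<circ> r) ` R" "p \<noteq> q"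
    then obtain r s where rs: "r \<in> R" "s \<in> R" "r \<noteq> s" "p = g \<circ> r" "q = g \<circ> s" by blast
    then have "disjnt (range r) (range s)" using R(3) by (auto simp: disjoint_rays_def pairwise_def)
    then have "r i \<noteq> s j" for i j by (auto simp: disjnt_def)
    then have "g (r i) \<noteq> g (s j)" for i j using rs ray eq_on[OF assms(1)] by blast
    then show "disjnt (range p) (range q)" using rs by (auto simp: disjnt_def)
  qed (use R(3) assms(1) ray_image in \<open>auto simp: disjoint_rays_def\<close>)
  moreover have "\<forall>r\<in>(\<lambda>r. g \<circ> r) ` R. end_equiv r (g \<circ> c)"
    using R(4) end_equiv_image[OF assms(1)] by blast
  ultimately show ?thesis unfolding thick_def using R(1,2) by (intro exI[of _ "(\<lambda>r. g \<circ> r) ` R"]) auto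
qed


text \<open>If \<open>g S\<close> misses the connected set \<open>S \<supseteq> F\<close>, the thick end \<open>a\<close> lies on the side of \<open>S\<close> for both separators
  \<open>g F\<close> and \<open>g\<inverse> F\<close>, so both cut \<open>b\<close> off from \<open>S\<close>. Pulling the first statement back by \<open>g\<close>,
  \<open>F\<close> separates \<open>b\<close> from \<open>g\<inverse> F\<close>, so that \<open>b\<close> reaches \<open>F\<close> without meeting \<open>g\<inverse> F\<close>.\<close>

lemma separated_end_not_thick:
  assumes rays: "is_ray a" "is_ray b"
    and two: "\<And>r. is_ray r \<Longrightarrow> end_equiv r a \<or> end_equiv r b"
    and F: "finite F" "F \<subseteq> V" "\<And>i j. \<not> linked F (a i) (b j)"
  shows "\<not> thick (card F) a"
proof
  assume thick: "thick (card F) a"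
  then obtain A where A: "finite A" "card F < card A" "disjoint_rays A" "\<forall>r\<in>A. end_equiv r a"
    unfolding thick_def by blast
  \<comment> \<open>\<open>B\<close> witnesses the thickness of \<open>b\<close> if \<open>b\<close>
    is thick, and is empty otherwise, so that one set \<open>S\<close> can serve both ends.\<close>
  obtain B where B: "finite B" "disjoint_rays B" "\<forall>r\<in>B. end_equiv r b"
    "thick (card F) b \<longrightarrow> card F < card B"
  proof (cases "thick (card F) b")
    case True
    then show ?thesis using that unfolding thick_def by blast
  next
    case False
    then show ?thesis using that[of "{}"] by (simp add: disjoint_rays_def)
  qed
  let ?T = "F \<union> (\<lambda>r. r 0) ` (A \<union> B)"
  have "A \<noteq> {}" using A(2) by auto
  moreover have "\<forall>r\<in>A \<union> B. r 0 \<in> V" using A(3) B(2) ray_in by (auto simp: disjoint_rays_def)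
  ultimately have "finite ?T" "?T \<subseteq> V" "?T \<noteq> {}" using A(1) B(1) F(1,2) by auto
  \<comment> \<open>\<open>S\<close> contains \<open>F\<close> and the starting points of all chosen
    rays. A set that misses the connected set \<open>S\<close> leaves all of \<open>S\<close> in one
    component.\<close>
  then obtain S where S: "finite S" "?T \<subseteq> S" "S \<subseteq> V"
    "\<And>u v. u \<in> S \<Longrightarrow> v \<in> S \<Longrightarrow> (u, v) \<in> rtrancl_on S E"
    using finite_connected_superset[of ?T] by metis
  obtain s where s: "s \<in> S" using S(2) \<open>A \<noteq> {}\<close> by blast
  have linked_S: "linked X u v" if "u \<in> S" "v \<in> S" "X \<inter> S = {}" for X u v
    using rtrancl_on_mono[OF subset_refl _ S(4)[OF that(1,2)], of "V - X"] S(3) that(3) by blast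
  have "range a \<subseteq> V" using ray_in[OF rays(1)] by blast
  moreover have "infinite (range a)" using rays(1) by (simp add: is_ray_def range_inj_infinite)
  ultimately have "infinite V" using infinite_super by blast
  then obtain g where g: "g \<in> G" "g ` S \<inter> S = {}" using separating_translate[OF _ S(1,3,1)] by auto
  define k where "k = inv_into V g"
  have k: "k \<in> G" using g(1) inv_closed by (simp add: k_def)
  have gk: "g (k x) = x" if "x \<in> V" for x using inv_right g(1) that by (simp add: k_def)
  have kS: "k ` S \<inter> S = {}" using gk g(2) S(3) by force
  \<comment> \<open>If \<open>b\<close> also converged to \<open>s\<close>, every ray would,
    including \<open>h \<circ> a\<close> and \<open>h \<circ> b\<close>, which the translate of
    \<open>F\<close> by \<open>h\<close> separates. Thickness of \<open>b\<close> would force that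
    convergence, by the argument used for \<open>a\<close>.\<close>
  have sides: "converges_to (h ` F) a s \<and> \<not> converges_to (h ` F) b s \<and> \<not> thick (card F) b"
    if h: "h \<in> G" "h ` S \<inter> S = {}" for h
  proof -
    have hF: "finite (h ` F)" "h ` F \<inter> S = {}" using F(1) h(2) S(2) by auto
    have small: "card (h ` F) \<le> card F" using F(1) by (rule card_image_le)
    have conv: "converges_to (h ` F) c s"
      if "disjoint_rays R" "\<forall>r\<in>R. end_equiv r c" "R \<subseteq> A \<union> B" "card F < card R" for R c
      using that(1)
    proof (rule thick_end_not_separated[OF _ _ _ hF(1)])
      show "linked (h ` F) (r 0) s" if "r \<in> R" for r
        using that \<open>R \<subseteq> A \<union> B\<close> S(2) s hF(2) by (intro linked_S) blast+
    qed (use that small in auto)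
    have a: "converges_to (h ` F) a s" using conv A by blast
    have "\<not> converges_to (h ` F) b s"
    proof
      assume b: "converges_to (h ` F) b s"
      have "converges_to (h ` F) r s" if "is_ray r" for r
        using two[OF that] a b converges_to_end_equiv end_equiv_sym hF(1) by blast
      then have "converges_to (h ` F) (h \<circ> a) s" "converges_to (h ` F) (h \<circ> b) s"
        using ray_image h(1) rays by blast+
      then obtain i j where "linked (h ` F) (h (a i)) s" "linked (h ` F) (h (b j)) s"
        unfolding converges_to_def by auto
      then have "linked (h ` F) (h (a i)) (h (b j))" by (blast intro: linked_trans linked_sym)
      then show False using linked_image_iff[OF h(1) F(2)] ray_in rays F(3) by blast
    qed
    moreover have "\<not> thick (card F) b" using conv[of B b] B calculation by blast
    ultimately show ?thesis using a by blast
  qed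
  \<comment> \<open>Otherwise \<open>k \<circ> b\<close> would share the thick end of
    \<open>a\<close>, and applying \<open>g\<close> would make \<open>b\<close> thick.\<close>
  have "end_equiv (k \<circ> b) b"
  proof (rule ccontr)
    assume "\<not> ?thesis"
    then have "end_equiv (k \<circ> b) a" using two ray_image k rays(2) by blast
    then have "thick (card F) (k \<circ> b)" using thick thick_end_equiv end_equiv_sym by blast
    then have "thick (card F) (g \<circ> (k \<circ> b))" using thick_image g(1) by blast
    moreover have "g \<circ> (k \<circ> b) = b" using gk ray_in rays(2) by auto
    ultimately show False using sides[OF g] by simp
  qed
  have far: "\<not> converges_to F b (k s)"
  proof
    assume "converges_to F b (k s)"
    then have "converges_to F (k \<circ> b) (k s)"
      using converges_to_end_equiv \<open>end_equiv (k \<circ> b) b\<close> end_equiv_sym F(1) by blast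
    then obtain N where "\<forall>i\<ge>N. linked F (k (b i)) (k s)" unfolding converges_to_def by auto
    then have "\<forall>i\<ge>N. linked (g ` F) (g (k (b i))) (g (k s))" using linked_image g(1) F(2) by blast
    then have "\<forall>i\<ge>N. linked (g ` F) (b i) s" using gk ray_in rays(2) s S(3) by (simp add: subset_iff)
    then show False using sides[OF g] unfolding converges_to_def by blast
  qed
  obtain N where N: "\<forall>i\<ge>N. \<forall>j\<ge>N. linked F (b i) (b j)"
    using end_equiv_refl[OF rays(2)] F(1) unfolding end_equiv_def by blast
  \<comment> \<open>For all large \<open>j\<close> this says that \<open>b\<close> converges to
    \<open>s\<close>, which \<open>sides\<close> forbids for the translate by
    \<open>k\<close>.\<close>
  have "linked (k ` F) (b j) s" if j: "N \<le> j" for j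
  proof -
    have cut: "\<not> linked F (b j) y" if y: "y \<in> k ` F" for y
    proof
      assume l: "linked F (b j) y"
      obtain x where x: "x \<in> F" "y = k x" using y by blast
      have "(k x, k s) \<in> rtrancl_on (k ` S) E" using x S(2,4) s rtrancl_on_image k by blast
      moreover have "k ` S \<subseteq> V - F" using kS S(2,3) image_in k by blast
      ultimately have "linked F y (k s)" using x rtrancl_on_mono[OF subset_refl] by simp
      then have "linked F (b j) (k s)" using l linked_trans by blast
      then have "\<forall>i\<ge>N. linked F (b i) (k s)" using N j by (meson linked_trans)
      then show False using far unfolding converges_to_def by blast
    qed
    \<comment> \<open>On a path from \<open>b j\<close> up to its first vertex in \<open>F\<close>,
      all earlier vertices are linked to \<open>b j\<close> outside \<open>F\<close>, so
      \<open>cut\<close> keeps them out of the translate by \<open>k\<close>; the vertex in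
      \<open>F\<close> is outside it by \<open>kS\<close>.\<close>
    have first_hit: "linked F (b j) y \<or> (\<exists>f\<in>F. linked (k ` F) (b j) f)"
      if "(b j, y) \<in> rtrancl_on V E" for y
      using that
    proof (induct rule: rtrancl_on_induct)
      case base
      then show ?case using N[rule_format, OF j j] by simp
    next
      case (step y z)
      show ?case
      proof (cases "linked F (b j) y \<and> z \<in> F")
        case True
        then have "linked (k ` F) (b j) y" using linked_avoiding[of "b j" y F "k ` F"] cut by simp
        moreover have "z \<in> V - k ` F" using True kS S(2) step by blast
        ultimately have "linked (k ` F) (b j) z" using rtrancl_on_into_rtrancl_on step(2) by metis
        then show ?thesis using True by blast
      next
        case False
        then show ?thesis using step(2-5) rtrancl_on_into_rtrancl_on by (metis DiffI)
      qed
    qed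
    have "F \<noteq> {}" using F(3) connected ray_in rays by (metis Diff_empty)
    then obtain e where e: "e \<in> F" by blast
    then have "(b j, e) \<in> rtrancl_on V E" using connected ray_in rays(2) F(2) by blast
    moreover have "\<not> linked F (b j) e" using e linked_notin by blast
    ultimately obtain f where f: "f \<in> F" "linked (k ` F) (b j) f" using first_hit by blast
    have "linked (k ` F) f s" using f(1) S(2) s kS by (intro linked_S) blast+
    with f(2) show ?thesis by (rule linked_trans)
  qed
  then show False using sides[OF k kS] unfolding converges_to_def by blast
qed

lemma two_ended_no_infinite_disjoint_rays:
  assumes rays: "is_ray a" "is_ray b" and "\<not> end_equiv a b"
    and two: "\<And>r. is_ray r \<Longrightarrow> end_equiv r a \<or> end_equiv r b"
    and R: "disjoint_rays R"
  shows "finite R"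
proof (rule ccontr)
  assume "infinite R"
  \<comment> \<open>By the weak criterion \<open>end_equivI\<close>, nonequivalence yields a finite
    set separating the whole rays, not only their tails.\<close>
  obtain X where X: "finite X" "\<And>i j. \<not> linked X (a i) (b j)"
    using end_equivI[OF rays] assms(3) by blast
  define F where "F = X \<inter> V"
  have F: "finite F" "F \<subseteq> V" "\<And>i j. \<not> linked F (a i) (b j)"
    using X by (auto simp: F_def Diff_Int)
  have thick: "thick (card F) c" if "infinite {r \<in> R. end_equiv r c}" for c
  proof -
    obtain Q where "Q \<subseteq> {r \<in> R. end_equiv r c}" "finite Q" "card Q = Suc (card F)"
      using infinite_arbitrarily_large[OF \<open>infinite {r \<in> R. end_equiv r c}\<close>] by blast
    moreover from this have "disjoint_rays Q"
      using R unfolding disjoint_rays_def by (auto intro: pairwise_subset)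
    ultimately show ?thesis unfolding thick_def by (intro exI[of _ Q]) auto
  qed
  have "R = {r \<in> R. end_equiv r a} \<union> {r \<in> R. end_equiv r b}"
    using R two by (auto simp: disjoint_rays_def)
  then consider "infinite {r \<in> R. end_equiv r a}" | "infinite {r \<in> R. end_equiv r b}"
    using \<open>infinite R\<close> by (metis finite_UnI)
  then show False
  proof cases
    case 1
    then show ?thesis using separated_end_not_thick[OF rays two F] thick[OF 1] by blast
  next
    case 2
    have "\<not> linked F (b i) (a j)" for i j using F(3) linked_sym by blast
    moreover have "end_equiv r b \<or> end_equiv r a" if "is_ray r" for r using two[OF that] by blast
    ultimately have "\<not> thick (card F) b"
      by (intro separated_end_not_thick[OF rays(2,1) _ F(1,2)]) auto
    then show ?thesis using thick[OF 2] by blast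
  qed
qed

end

section \<open>Common ancestors\<close>

text \<open>The two ends enter the argument on ancestors only through the finiteness in
  \<open>few_rays\<close>. Transitivity comes with an explicit left inverse \<open>h\<close>, by
  which common ancestors are pulled back.\<close>

locale vertex_transitive_dag =
  fixes V :: "'a set" and A :: "('a \<times> 'a) set"
  assumes arcs_in: "A \<subseteq> V \<times> V"
    and nonempty: "V \<noteq> {}"
    and connected: "u \<in> V \<Longrightarrow> v \<in> V \<Longrightarrow> (u, v) \<in> rtrancl_on V (A \<union> A\<inverse>)"
    and acyclic: "acyclic A"
    and in_neighbour: "v \<in> V \<Longrightarrow> \<exists>u. (u, v) \<in> A"
    and transitive: "u \<in> V \<Longrightarrow> v \<in> V \<Longrightarrow> \<exists>g h. g u = v \<and> (\<forall>x\<in>V. h (g x) = x) \<and>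
      (\<forall>x y. (x, y) \<in> A \<longrightarrow> (g x, g y) \<in> A) \<and> (\<forall>x y. (x, y) \<in> A \<longrightarrow> (h x, h y) \<in> A)"
    and few_rays: "\<forall>r\<in>R. inj r \<and> (\<forall>i. (r (Suc i), r i) \<in> A) \<Longrightarrow>
      pairwise (\<lambda>r s. disjnt (range r) (range s)) R \<Longrightarrow> finite (R :: (nat \<Rightarrow> 'a) set)"
begin

definition anc :: "'a \<Rightarrow> 'a set" where
  "anc v = {u. (u, v) \<in> A\<^sup>*}"

lemma anc_refl: "v \<in> anc v"
  by (simp add: anc_def)

lemma anc_trans: "u \<in> anc v \<Longrightarrow> v \<in> anc w \<Longrightarrow> u \<in> anc w"
  by (auto simp: anc_def)

lemma anc_in: "u \<in> anc v \<Longrightarrow> v \<in> V \<Longrightarrow> u \<in> V"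
  using arcs_in by (auto simp: anc_def elim: converse_rtranclE)

lemma anc_image:
  assumes "\<forall>x y. (x, y) \<in> A \<longrightarrow> (g x, g y) \<in> A" "u \<in> anc v"
  shows "g u \<in> anc (g v)"
proof -
  have "(u, v) \<in> A\<^sup>*" using assms(2) by (simp add: anc_def)
  then have "(g u, g v) \<in> A\<^sup>*"
    using assms(1) by induct (auto intro: rtrancl_into_rtrancl)
  then show ?thesis by (simp add: anc_def)
qed

definition back_ray :: "(nat \<Rightarrow> 'a) \<Rightarrow> bool" where
  "back_ray r \<longleftrightarrow> inj r \<and> (\<forall>i. (r (Suc i), r i) \<in> A)"

text \<open>In-neighbours are chosen repeatedly; acyclicity excludes repetition.\<close>

lemma back_ray_from:
  assumes "v \<in> V"
  shows "\<exists>r. back_ray r \<and> r 0 = v \<and> range r \<subseteq> anc v"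
proof -
  obtain p where p: "\<And>v. v \<in> V \<Longrightarrow> (p v, v) \<in> A" using in_neighbour by metis
  define r where "r i = (p ^^ i) v" for i
  have V: "r i \<in> V" for i
  proof (induct i)
    case (Suc i)
    then show ?case using p[OF Suc] arcs_in by (auto simp: r_def)
  qed (simp add: r_def assms)
  have step: "(r (Suc i), r i) \<in> A" for i using p[OF V[of i]] by (simp add: r_def)
  have less: "(r j, r i) \<in> A\<^sup>+" if "i < j" for i j
    using that
  proof (induct j)
    case (Suc j)
    then show ?case using step[of j] by (cases "i = j") (auto intro: trancl_into_trancl2)
  qed simp
  have "r i \<noteq> r j" if "i < j" for i j
    using less[OF that] acyclic by (auto simp: acyclic_def)
  then have "inj r" by (metis injI linorder_neqE_nat)
  moreover have "r i \<in> anc v" for i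
    using less[of 0 i] by (cases i) (auto simp: r_def anc_def dest: trancl_into_rtrancl)
  ultimately show ?thesis
    using step by (intro exI[of _ r]) (auto simp: back_ray_def r_def)
qed

text \<open>If some vertex had two ancestors without a common ancestor, then by transitivity so would every
  vertex, and splitting off one of the two at each step yields infinitely many pairwise disjoint
  sets of ancestors, each of which contains a ray.\<close>

lemma ancestors_have_common_ancestor:
  assumes "v \<in> V" "a \<in> anc v" "b \<in> anc v"
  shows "anc a \<inter> anc b \<noteq> {}"
proof
  assume ab: "anc a \<inter> anc b = {}"
  \<comment> \<open>A common ancestor of \<open>g a\<close> and \<open>g b\<close> would be sent by
    \<open>h\<close> to one of \<open>a\<close> and \<open>b\<close>.\<close>
  have "\<exists>a' b'. a' \<in> anc x \<and> b' \<in> anc x \<and> anc a' \<inter> anc b' = {}" if x: "x \<in> V" for x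
  proof -
    obtain g h where gh: "g v = x" "\<forall>x\<in>V. h (g x) = x"
        "\<forall>x y. (x, y) \<in> A \<longrightarrow> (g x, g y) \<in> A" "\<forall>x y. (x, y) \<in> A \<longrightarrow> (h x, h y) \<in> A"
      using transitive[OF assms(1) x] by blast
    have "anc (g a) \<inter> anc (g b) = {}"
    proof (rule ccontr)
      assume "anc (g a) \<inter> anc (g b) \<noteq> {}"
      then obtain y where "y \<in> anc (g a)" "y \<in> anc (g b)" by blast
      then have "h y \<in> anc (h (g a))" "h y \<in> anc (h (g b))" using anc_image[OF gh(4)] by blast+
      then show False using ab gh(2) anc_in assms by auto
    qed
    moreover have "g a \<in> anc x" "g b \<in> anc x" using anc_image[OF gh(3)] assms gh(1) by blast+
    ultimately show ?thesis by blast
  qed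
  then obtain \<alpha> \<beta> where split: "\<And>x. x \<in> V \<Longrightarrow> \<alpha> x \<in> anc x \<and> \<beta> x \<in> anc x \<and> anc (\<alpha> x) \<inter> anc (\<beta> x) = {}"
    by metis
  \<comment> \<open>The sequence continues along the branch \<alpha>, and the branch \<beta> is
    split off at each step.\<close>
  define x where "x i = (\<alpha> ^^ i) v" for i
  have x_Suc: "x (Suc i) = \<alpha> (x i)" for i by (simp add: x_def)
  have V: "x i \<in> V" for i
  proof (induct i)
    case (Suc i)
    then show ?case using split[OF Suc] anc_in[OF _ Suc] by (simp add: x_Suc)
  qed (simp add: x_def assms)
  have descend: "x j \<in> anc (x i)" if "i \<le> j" for i j
    using that
  proof (induct j rule: dec_induct)
    case (step j)
    then show ?case using split[OF V[of j]] anc_trans by (auto simp: x_Suc)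
  qed (rule anc_refl)
  \<comment> \<open>For \<open>i < j\<close>, \<open>\<beta> (x j)\<close> is an ancestor of
    \<open>x (Suc i) = \<alpha> (x i)\<close>, whose ancestors are disjoint from those of
    \<open>\<beta> (x i)\<close>.\<close>
  have disj: "anc (\<beta> (x i)) \<inter> anc (\<beta> (x j)) = {}" if "i < j" for i j
  proof -
    have "\<beta> (x j) \<in> anc (\<alpha> (x i))"
      using descend[of "Suc i" j] that split[OF V[of j]] anc_trans by (auto simp: x_Suc)
    then have "anc (\<beta> (x j)) \<subseteq> anc (\<alpha> (x i))" using anc_trans by blast
    then show ?thesis using split[OF V[of i]] by blast
  qed
  have "\<beta> (x i) \<in> V" for i using split[OF V[of i]] anc_in V by blast
  then have "\<exists>r. back_ray r \<and> range r \<subseteq> anc (\<beta> (x i))" for i using back_ray_from by metis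
  then obtain \<rho> where \<rho>: "\<And>i. back_ray (\<rho> i)" "\<And>i. range (\<rho> i) \<subseteq> anc (\<beta> (x i))" by metis
  have \<rho>_disj: "disjnt (range (\<rho> i)) (range (\<rho> j))" if "i \<noteq> j" for i j
  proof -
    have "anc (\<beta> (x i)) \<inter> anc (\<beta> (x j)) = {}"
      using disj[of i j] disj[of j i] that by (metis Int_commute nat_neq_iff)
    then show ?thesis using \<rho>(2)[of i] \<rho>(2)[of j] by (auto simp: disjnt_def)
  qed
  have "inj \<rho>"
  proof (rule injI, rule ccontr)
    fix i j assume "\<rho> i = \<rho> j" "i \<noteq> j"
    then show False using \<rho>_disj[of i j] by (auto simp: disjnt_def)
  qed
  moreover have "finite (range \<rho>)"
  proof (rule few_rays)
    show "pairwise (\<lambda>r s. disjnt (range r) (range s)) (range \<rho>)"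
      unfolding pairwise_def using \<rho>_disj by (metis rangeE)
  qed (use \<rho>(1) in \<open>auto simp: back_ray_def\<close>)
  ultimately show False by (simp add: finite_image_iff)
qed

text \<open>Induction along an undirected path from \<open>u\<close>. Moving to an out-neighbour
  keeps the common ancestor \<open>c\<close>. Moving from \<open>y\<close> to an in-neighbour
  \<open>z\<close> makes \<open>c\<close> and \<open>z\<close> two ancestors of \<open>y\<close>, to
  which \<open>ancestors_have_common_ancestor\<close> applies.\<close>

lemma common_ancestor:
  assumes "u \<in> V" "v \<in> V"
  shows "anc u \<inter> anc v \<noteq> {}"
  using connected[OF assms]
proof (induct rule: rtrancl_on_induct)
  case base
  then show ?case using anc_refl by blast
next
  case (step y z)
  then obtain c where c: "c \<in> anc u" "c \<in> anc y" by blast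
  consider "y \<in> anc z" | "z \<in> anc y" using step(2) by (auto simp: anc_def)
  then show ?case
  proof cases
    case 1
    then show ?thesis using c anc_trans by blast
  next
    case 2
    then have "anc c \<inter> anc z \<noteq> {}" using ancestors_have_common_ancestor step(3) c(2) by blast
    then show ?thesis using c(1) anc_trans by blast
  qed
qed

text \<open>A maximal family of disjoint rays is finite, and its vertices form such a set.\<close>

lemma countable_ancestor_set:
  "\<exists>W. countable W \<and> W \<subseteq> V \<and> (\<forall>v\<in>V. W \<inter> anc v \<noteq> {})"
proof (rule ccontr)
  assume none: "\<nexists>W. countable W \<and> W \<subseteq> V \<and> (\<forall>v\<in>V. W \<inter> anc v \<noteq> {})"
  have ray_in: "range r \<subseteq> V" if "back_ray r" for r
    using that arcs_in by (auto simp: back_ray_def)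
  \<comment> \<open>The vertices of a finite family form a countable set, which by
    \<open>none\<close> misses all ancestors of some \<open>v\<close>; a ray among these ancestors
    enlarges the family.\<close>
  have "\<exists>r\<in>Collect back_ray. \<forall>q\<in>Q. disjnt (range r) (range q)"
    if Q: "finite Q" "Q \<subseteq> Collect back_ray" for Q
  proof -
    have "countable (\<Union>q\<in>Q. range q)" using Q(1) by (simp add: countable_finite)
    moreover have "(\<Union>q\<in>Q. range q) \<subseteq> V" using Q(2) ray_in by blast
    ultimately have "\<not> (\<forall>v\<in>V. (\<Union>q\<in>Q. range q) \<inter> anc v \<noteq> {})" using none by metis
    then obtain v where v: "v \<in> V" "(\<Union>q\<in>Q. range q) \<inter> anc v = {}" by blast
    obtain r where "back_ray r" "range r \<subseteq> anc v" using back_ray_from[OF v(1)] by blast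
    then show ?thesis using v(2) by (intro bexI[of _ r]) (auto simp: disjnt_def)
  qed
  then have "\<exists>R\<subseteq>Collect back_ray. infinite R \<and> pairwise (\<lambda>r s. disjnt (range r) (range s)) R"
    by (rule infinite_disjoint_family) auto
  then obtain R where R: "R \<subseteq> Collect back_ray" "infinite R"
      "pairwise (\<lambda>r s. disjnt (range r) (range s)) R" by blast
  have "finite R" using R(1,3) by (intro few_rays) (auto simp: back_ray_def)
  then show False using R(2) by blast
qed

text \<open>Walks run against the arcs, so an older ancestor is appended at the end of the
  list.\<close>

lemma walk_to_ancestor:
  assumes "u \<in> anc v"
  shows "\<exists>t. successively (\<lambda>x y. (y, x) \<in> A) (v # t) \<and> last (v # t) = u"
proof -
  have "(u, v) \<in> A\<^sup>*" using assms by (simp add: anc_def)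
  then show ?thesis
  proof (induct rule: converse_rtrancl_induct)
    case base
    show ?case by (intro exI[of _ "[]"]) simp
  next
    case (step y z)
    then obtain t where t: "successively (\<lambda>x y. (y, x) \<in> A) (v # t)" "last (v # t) = z" by blast
    then have "successively (\<lambda>x y. (y, x) \<in> A) (v # t @ [y])"
      using step(1) successively_append_iff[of _ "v # t" "[y]"] by auto
    then show ?case by (intro exI[of _ "t @ [y]"]) auto
  qed
qed

text \<open>A finite backward walk is extended repeatedly through a common ancestor of its last
  vertex and the next point of \<open>W\<close>. Each vertex has some \<open>w n\<close> as an
  ancestor, hence also the last vertex of the walk \<open>p n\<close>.\<close>

theorem backward_path_with_all_descendants:
  "\<exists>x. (\<forall>i. (x (Suc i), x i) \<in> A) \<and> (\<forall>v\<in>V. \<exists>i. x i \<in> anc v)"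
proof -
  obtain W where W: "countable W" "W \<subseteq> V" "\<forall>v\<in>V. W \<inter> anc v \<noteq> {}"
    using countable_ancestor_set by blast
  have "W \<noteq> {}" using W(3) nonempty by blast
  \<comment> \<open>\<open>W\<close> may be finite, so the enumeration may repeat points.\<close>
  then obtain w :: "nat \<Rightarrow> 'a" where w: "range w = W" using W(1) by (metis range_from_nat_into)
  let ?walk = "successively (\<lambda>x y. (y, x) \<in> A)"
  let ?P = "\<lambda>n p. p \<noteq> [] \<and> ?walk p \<and> last p \<in> V \<and> last p \<in> anc (w n)"
  let ?Q = "\<lambda>p q. \<exists>t. t \<noteq> [] \<and> q = p @ t"
  have "\<exists>p. \<forall>n. ?P n (p n) \<and> ?Q (p n) (p (Suc n))"
  proof (rule dependent_nat_choice)
    show "\<exists>p. ?P 0 p" using w W(2) anc_refl by (intro exI[of _ "[w 0]"]) auto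
  next
    fix p n assume p: "?P n p"
    have wn: "w (Suc n) \<in> V" using w W(2) by blast
    then obtain c where c: "c \<in> anc (last p)" "c \<in> anc (w (Suc n))"
      using common_ancestor p by blast
    then have "c \<in> V" using anc_in p by blast
    \<comment> \<open>The additional in-neighbour \<open>d\<close> makes the extension proper even
      if \<open>c\<close> is already the last vertex of \<open>p\<close>.\<close>
    then obtain d where d: "(d, c) \<in> A" using in_neighbour by blast
    obtain t where t: "?walk (last p # t)" "last (last p # t) = c"
      using walk_to_ancestor[OF c(1)] by blast
    have "?walk (p @ t @ [d])"
    proof -
      have "?walk ((last p # t) @ [d])" using t d by (simp only: successively_append_iff) auto
      then have "?walk (last p # (t @ [d]))" by simp
      then show ?thesis using p
        by (cases "t @ [d]") (auto simp: successively_append_iff)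
    qed
    moreover have "d \<in> anc c" using d by (auto simp: anc_def)
    ultimately show "\<exists>q. ?P (Suc n) q \<and> ?Q p q"
      using p d arcs_in c(2) anc_trans by (intro exI[of _ "p @ t @ [d]"]) auto
  qed
  then obtain p where p: "\<And>n. ?P n (p n)" "\<And>n. ?Q (p n) (p (Suc n))" by blast
  have pre: "\<exists>t. p n = p m @ t" if "m \<le> n" for m n
    using that
  proof (induct n rule: dec_induct)
    case (step n)
    then show ?case using p(2)[of n] by auto
  qed simp
  have len: "n < length (p n)" for n
  proof (induct n)
    case 0
    then show ?case using p(1)[of 0] by simp
  next
    case (Suc n)
    obtain t where "t \<noteq> []" "p (Suc n) = p n @ t" using p(2)[of n] by blast
    then show ?case using Suc by (cases t) auto
  qed
  \<comment> \<open>The limit of the walks: they are prefixes of one another and \<open>p i\<close>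
    has more than \<open>i\<close> vertices, so position \<open>i\<close> exists in
    \<open>p i\<close> and is the same in every \<open>p n\<close> that is long enough.\<close>
  define x where "x i = p i ! i" for i
  have x: "x i = p n ! i" if "i < length (p n)" for i n
  proof (cases "i \<le> n")
    case True
    then obtain t where "p n = p i @ t" using pre by blast
    then show ?thesis using len[of i] by (simp add: x_def nth_append)
  next
    case False
    then obtain t where "p i = p n @ t" using pre[of n i] by auto
    then show ?thesis using that by (simp add: x_def nth_append)
  qed
  have "(x (Suc i), x i) \<in> A" for i
  proof -
    have "x i = p (Suc i) ! i" "x (Suc i) = p (Suc i) ! Suc i" using x len[of "Suc i"] by auto
    then show ?thesis using p(1)[of "Suc i"] len[of "Suc i"] by (auto simp: successively_conv_nth)
  qed
  moreover have "\<exists>i. x i \<in> anc v" if v: "v \<in> V" for v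
  proof -
    obtain n where n: "w n \<in> anc v" using W(3) v w by blast
    have "last (p n) = x (length (p n) - 1)" using p(1)[of n] x[of "length (p n) - 1" n] by (simp add: last_conv_nth)
    then have "x (length (p n) - 1) \<in> anc v" using p(1)[of n] n anc_trans by metis
    then show ?thesis by blast
  qed
  ultimately show ?thesis by blast
qed

end

section \<open>Distinct walks and descendants\<close>

lemma rtrancl_on_imp_distinct_walk:
  assumes "(u, v) \<in> rtrancl_on F E"
  shows "\<exists>p. p \<noteq> [] \<and> hd p = u \<and> last p = v \<and> distinct p \<and> set p \<subseteq> F \<and> set (vwalk_arcs p) \<subseteq> E"
proof -
  \<comment> \<open>Restricting the arcs to \<open>F\<close> gives a well-formed digraph, in which
    reachability provides a path without repeated vertices.\<close>
  let ?H = "\<lparr>pverts = F, parcs = E \<inter> F \<times> F\<rparr>"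
  interpret H: pair_wf_digraph ?H by unfold_locales auto
  have "(u, v) \<in> rtrancl_on F (E \<inter> F \<times> F)"
    using assms by (induct rule: rtrancl_on_induct) (auto intro: rtrancl_on_into_rtrancl_on)
  then have "u \<rightarrow>\<^sup>*\<^bsub>?H\<^esub> v" by (simp add: reachable_def)
  then obtain p where "vpath p ?H" "hd p = u" "last p = v"
    using H.reachable_vpath_conv by blast
  then show ?thesis by (intro exI[of _ p]) (auto simp: vpath_def vwalk_def)
qed

lemma vwalk_arcs_nth:
  "Suc i < length p \<Longrightarrow> (p ! i, p ! Suc i) \<in> set (vwalk_arcs p)"
proof (induct p arbitrary: i rule: vwalk_arcs.induct)
  case (3 x y xs)
  then show ?case by (cases i) auto
qed auto

text \<open>A walk without repeated vertices satisfies
  \<open>us ! (i - 1) \<noteq> us ! (i + 1)\<close> automatically, so plain reachability already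
  gives an s-arc.\<close>

lemma reachable_imp_desc:
  assumes "(u, v) \<in> rtrancl_on (pverts D) (parcs D)"
  shows "v \<in> desc D u"
proof -
  obtain p where p: "p \<noteq> []" "hd p = u" "last p = v" "distinct p" "set p \<subseteq> pverts D"
      "set (vwalk_arcs p) \<subseteq> parcs D"
    using rtrancl_on_imp_distinct_walk[OF assms] by blast
  have "s_arc D (length p - 1) p"
    unfolding s_arc_def using p vwalk_arcs_nth[of _ p] by (auto simp: nth_eq_iff_index_eq)
  then show ?thesis unfolding desc_def using p by (auto simp: hd_conv_nth last_conv_nth)
qed

section \<open>Ends and automorphisms of digraphs\<close>

lemma parcs_mk_symmetric_pair: "parcs (mk_symmetric (with_proj D)) = parcs D \<union> (parcs D)\<inverse>"
  by (force simp: parcs_mk_symmetric)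

lemma walk_imp_rtrancl_on:
  assumes "p \<noteq> []" "set p \<subseteq> F" "set (vwalk_arcs p) \<subseteq> E"
  shows "(hd p, last p) \<in> rtrancl_on F E"
  using assms
proof (induct p rule: vwalk_arcs.induct)
  case (3 x y xs)
  then have "(y, last (y # xs)) \<in> rtrancl_on F E" by simp
  then show ?case using 3 by (auto intro: converse_rtrancl_on_into_rtrancl_on)
qed auto

text \<open>A finite set meets only finitely many disjoint joining paths, so one of infinitely many
  avoids it. Conversely, joining paths are picked one by one outside the finitely many vertices of
  the earlier ones.\<close>

lemma ray_equiv_iff_end_equiv:
  assumes "connected_graph (pverts D) (parcs (mk_symmetric (with_proj D)))"
  shows "(a, b) \<in> ray_equiv D \<longleftrightarrow>
    connected_graph.end_equiv (pverts D) (parcs (mk_symmetric (with_proj D))) a b"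
proof -
  let ?E = "parcs (mk_symmetric (with_proj D))"
  interpret connected_graph "pverts D" ?E by fact
  have ray: "ray D r \<longleftrightarrow> is_ray r" for r by (simp add: ray_def is_ray_def)
  have vpath_iff: "vpath p (with_proj (mk_symmetric (with_proj D))) \<longleftrightarrow>
      p \<noteq> [] \<and> distinct p \<and> set p \<subseteq> pverts D \<and> set (vwalk_arcs p) \<subseteq> ?E" for p
    by (auto simp: vpath_def vwalk_def)
  let ?J = "{p. vpath p (with_proj (mk_symmetric (with_proj D))) \<and> hd p \<in> range a \<and> last p \<in> range b}"
  show ?thesis
  proof
    assume "(a, b) \<in> ray_equiv D"
    then obtain P where P: "is_ray a" "is_ray b" "infinite P" "P \<subseteq> ?J"
        "pairwise (\<lambda>p q. disjnt (set p) (set q)) P"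
      unfolding ray_equiv_def ray by blast
    show "end_equiv a b"
    proof (rule end_equivI[OF P(1,2)])
      fix X :: "'a set" assume X: "finite X"
      have "\<exists>p\<in>P. set p \<inter> X = {}"
      proof (rule ccontr)
        assume "\<not> ?thesis"
        then have "\<forall>p\<in>P. \<exists>x. x \<in> set p \<inter> X" by blast
        then obtain f where f: "\<And>p. p \<in> P \<Longrightarrow> f p \<in> set p \<inter> X" by metis
        have "inj_on f P"
        proof (rule inj_onI, rule ccontr)
          fix p q assume pq: "p \<in> P" "q \<in> P" "f p = f q" "p \<noteq> q"
          then have "disjnt (set p) (set q)" using P(5) by (auto simp: pairwise_def)
          then show False using f[OF pq(1)] f[OF pq(2)] pq(3) by (auto simp: disjnt_def)
        qed
        moreover have "f ` P \<subseteq> X" using f by blast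
        ultimately show False using P(3) X inj_on_finite by blast
      qed
      then obtain p where p: "p \<in> ?J" "set p \<inter> X = {}" using P(4) by blast
      then have "linked X (hd p) (last p)" by (intro walk_imp_rtrancl_on) (auto simp: vpath_iff)
      moreover obtain i j where "hd p = a i" "last p = b j" using p(1) by blast
      ultimately show "\<exists>i j. linked X (a i) (b j)" by metis
    qed
  next
    assume ab: "end_equiv a b"
    have "\<exists>p\<in>?J. \<forall>q\<in>Q. disjnt (set p) (set q)" if Q: "finite Q" "Q \<subseteq> ?J" for Q
    proof -
      let ?X = "\<Union>q\<in>Q. set q"
      have "finite ?X" using Q by blast
      then obtain N where "\<forall>i\<ge>N. \<forall>j\<ge>N. linked ?X (a i) (b j)"
        using ab unfolding end_equiv_def by presburger
      then have "linked ?X (a N) (b N)" by blast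
      from rtrancl_on_imp_distinct_walk[OF this]
      obtain p where p: "p \<noteq> []" "hd p = a N" "last p = b N" "distinct p" "set p \<subseteq> pverts D - ?X"
          "set (vwalk_arcs p) \<subseteq> ?E" by blast
      then have "p \<in> ?J" by (auto simp: vpath_iff)
      moreover have "\<forall>q\<in>Q. disjnt (set p) (set q)" using p(5) by (auto simp: disjnt_def)
      ultimately show ?thesis by blast
    qed
    moreover have "set p \<noteq> {}" if "p \<in> ?J" for p using that by (simp add: vpath_iff)
    ultimately have "\<exists>P\<subseteq>?J. infinite P \<and> pairwise (\<lambda>p q. disjnt (set p) (set q)) P"
      by (rule infinite_disjoint_family)
    then obtain P where "P \<subseteq> ?J" "infinite P" "pairwise (\<lambda>p q. disjnt (set p) (set q)) P"
      by blast
    moreover have "ray D a" "ray D b" using ab by (simp_all add: ray end_equiv_def)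
    ultimately show "(a, b) \<in> ray_equiv D" unfolding ray_equiv_def by auto
  qed
qed

lemma two_ends_representatives:
  assumes "connected_graph (pverts D) (parcs (mk_symmetric (with_proj D)))" "card (ends D) = 2"
  shows "\<exists>a b. ray D a \<and> ray D b \<and> (a, b) \<notin> ray_equiv D \<and>
    (\<forall>r. ray D r \<longrightarrow> (r, a) \<in> ray_equiv D \<or> (r, b) \<in> ray_equiv D)"
proof -
  interpret connected_graph "pverts D" "parcs (mk_symmetric (with_proj D))" by fact
  note iff = ray_equiv_iff_end_equiv[OF assms(1)]
  have refl: "(r, r) \<in> ray_equiv D" if "ray D r" for r
    using that end_equiv_refl[of r] by (simp add: iff ray_def is_ray_def)
  have classes: "ray_equiv D `` {r} = ray_equiv D `` {s}" if "(r, s) \<in> ray_equiv D" for r s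
  proof -
    have "(r, q) \<in> ray_equiv D \<longleftrightarrow> (s, q) \<in> ray_equiv D" for q
      using that unfolding iff by (meson end_equiv_sym end_equiv_trans)
    then show ?thesis by blast
  qed
  obtain C C' where C: "ends D = {C, C'}" "C \<noteq> C'" using assms(2) by (auto simp: card_2_iff)
  then have "C \<in> ends D" "C' \<in> ends D" by auto
  then obtain a b where ab: "ray D a" "C = ray_equiv D `` {a}" "ray D b" "C' = ray_equiv D `` {b}"
    unfolding ends_def by (auto elim!: quotientE)
  have "(r, a) \<in> ray_equiv D \<or> (r, b) \<in> ray_equiv D" if r: "ray D r" for r
  proof -
    have "ray_equiv D `` {r} \<in> ends D" using r by (auto simp: ends_def intro: quotientI)
    then have "ray_equiv D `` {r} = ray_equiv D `` {a} \<or> ray_equiv D `` {r} = ray_equiv D `` {b}"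
      using C ab by auto
    then show ?thesis using refl[OF ab(1)] refl[OF ab(3)] by blast
  qed
  then show ?thesis using ab C(2) classes by blast
qed

section \<open>Automorphisms and arc-transitivity\<close>

lemma automorphism_bij: "automorphism D f \<Longrightarrow> bij_betw f (pverts D) (pverts D)"
  by (simp add: automorphism_def)

lemma automorphism_arc_iff:
  "automorphism D f \<Longrightarrow> u \<in> pverts D \<Longrightarrow> v \<in> pverts D \<Longrightarrow> (f u, f v) \<in> parcs D \<longleftrightarrow> (u, v) \<in> parcs D"
  by (simp add: automorphism_def)

lemma automorphism_comp:
  assumes "automorphism D f" "automorphism D g"
  shows "automorphism D (f \<circ> g)"
  unfolding automorphism_def
proof (intro conjI ballI)
  show "bij_betw (f \<circ> g) (pverts D) (pverts D)"
    using assms automorphism_bij bij_betw_trans by metis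
  fix u v assume uv: "u \<in> pverts D" "v \<in> pverts D"
  then have "g u \<in> pverts D" "g v \<in> pverts D"
    using bij_betwE[OF automorphism_bij[OF assms(2)]] by auto
  then show "(u, v) \<in> parcs D \<longleftrightarrow> ((f \<circ> g) u, (f \<circ> g) v) \<in> parcs D"
    using uv by (simp add: automorphism_arc_iff[OF assms(1)] automorphism_arc_iff[OF assms(2)])
qed

lemma automorphism_inv:
  assumes "automorphism D f"
  shows "automorphism D (inv_into (pverts D) f)"
  unfolding automorphism_def
proof (intro conjI ballI)
  note bij = automorphism_bij[OF assms]
  let ?h = "inv_into (pverts D) f"
  show bij': "bij_betw ?h (pverts D) (pverts D)" using bij by (rule bij_betw_inv_into)
  fix u v assume uv: "u \<in> pverts D" "v \<in> pverts D"
  then have "?h u \<in> pverts D" "?h v \<in> pverts D" using bij_betwE[OF bij'] by auto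
  then have "(f (?h u), f (?h v)) \<in> parcs D \<longleftrightarrow> (?h u, ?h v) \<in> parcs D"
    by (rule automorphism_arc_iff[OF assms])
  then show "(u, v) \<in> parcs D \<longleftrightarrow> (?h u, ?h v) \<in> parcs D"
    using uv by (simp add: bij_betw_inv_into_right[OF bij])
qed

lemma automorphism_arc:
  assumes "pair_wf_digraph D" "automorphism D f" "(u, v) \<in> parcs D"
  shows "(f u, f v) \<in> parcs D"
proof -
  interpret pair_wf_digraph D by fact
  show ?thesis using assms(3) in_arcsD1 in_arcsD2 automorphism_arc_iff[OF assms(2)] by blast
qed

lemma automorphism_rtrancl:
  assumes "pair_wf_digraph D" "automorphism D f" "(u, v) \<in> (parcs D)\<^sup>*"
  shows "(f u, f v) \<in> (parcs D)\<^sup>*"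
  using assms(3) by induct (auto intro: rtrancl_into_rtrancl automorphism_arc[OF assms(1,2)])

lemma s_arc_transitive:
  assumes "highly_arc_transitive D" "s_arc D s us" "s_arc D s vs"
  shows "\<exists>f. automorphism D f \<and> map f us = vs"
  using assms(1)[unfolded highly_arc_transitive_def, rule_format, of s us vs] assms(2,3) by simp

lemma vertex_transitive:
  assumes "highly_arc_transitive D" "u \<in> pverts D" "v \<in> pverts D"
  shows "\<exists>f. automorphism D f \<and> f u = v"
proof -
  have "s_arc D 0 [u]" "s_arc D 0 [v]" using assms by (auto simp: s_arc_def)
  from s_arc_transitive[OF assms(1) this] show ?thesis by simp
qed

lemma arc_transitive:
  assumes "pair_wf_digraph D" "highly_arc_transitive D" "(u, v) \<in> parcs D" "(x, y) \<in> parcs D"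
  shows "\<exists>f. automorphism D f \<and> f u = x \<and> f v = y"
proof -
  interpret pair_wf_digraph D by fact
  have "s_arc D 1 [u, v]" "s_arc D 1 [x, y]"
    using assms(3,4) in_arcsD1 in_arcsD2 by (auto simp: s_arc_def)
  from s_arc_transitive[OF assms(2) this] show ?thesis by simp
qed

text \<open>An arc on a directed cycle has a directed path back from its head to its tail. By
  arc-transitivity every arc has one, so undirected walks can be replaced by directed ones.\<close>

lemma cyclic_imp_reachable:
  assumes "pair_wf_digraph D" "highly_arc_transitive D" "\<not> acyclic (parcs D)"
    and "(u, v) \<in> rtrancl_on (pverts D) (parcs D \<union> (parcs D)\<inverse>)"
  shows "(u, v) \<in> (parcs D)\<^sup>*"
proof -
  obtain x where "(x, x) \<in> (parcs D)\<^sup>+" using assms(3) by (auto simp: acyclic_def)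
  then obtain y where y: "(x, y) \<in> parcs D" "(y, x) \<in> (parcs D)\<^sup>*" by (meson tranclD)
  have reverse: "(t, s) \<in> (parcs D)\<^sup>*" if "(s, t) \<in> parcs D" for s t
    using arc_transitive[OF assms(1,2) y(1) that] automorphism_rtrancl[OF assms(1) _ y(2)] by blast
  show ?thesis
    using assms(4)
  proof (induct rule: rtrancl_on_induct)
    case (step w z)
    then have "(w, z) \<in> (parcs D)\<^sup>*" using reverse[of z w] by blast
    with step(5) show ?case by (rule rtrancl_trans)
  qed simp
qed

theorem theorem3p21:
  fixes D :: "'a pair_pre_digraph"
  assumes "pair_loopfree_digraph D"
    and "Digraph_Component.connected (with_proj D)"
    and "highly_arc_transitive D"
    and "card (ends D) = 2"
  shows "\<exists>L. directed_line D L \<and> with_proj D \<restriction> desc_line D L = with_proj D"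
proof -
  interpret pair_loopfree_digraph D by fact
  have wf: "pair_wf_digraph D" by unfold_locales
  let ?V = "pverts D" and ?A = "parcs D" and ?E = "parcs (mk_symmetric (with_proj D))"
  note E = parcs_mk_symmetric_pair[of D]
  have A: "?A \<subseteq> ?V \<times> ?V" using in_arcsD1 in_arcsD2 by auto
  have conn: "(u, v) \<in> rtrancl_on ?V ?E" if "u \<in> ?V" "v \<in> ?V" for u v
    using assms(2) that
    by (auto simp: Digraph_Component.connected_def strongly_connected_def reachable_def)
  interpret transitive_graph ?V ?E "{f. automorphism D f}"
  proof unfold_locales
    show "?E \<subseteq> ?V \<times> ?V" using A by (auto simp: E)
    show "sym ?E" by (auto simp: E sym_def)
    show "(g u, g v) \<in> ?E" if "g \<in> {f. automorphism D f}" "(u, v) \<in> ?E" for g u v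
      using that automorphism_arc[OF wf] by (auto simp: E)
  qed (use conn automorphism_bij automorphism_comp automorphism_inv vertex_transitive[OF assms(3)]
      in \<open>auto simp del: comp_apply\<close>)
  have ray: "ray D r \<longleftrightarrow> is_ray r" for r by (simp add: ray_def is_ray_def)
  note iff = ray_equiv_iff_end_equiv[OF connected_graph_axioms]
  obtain a b where ab: "is_ray a" "is_ray b" "\<not> end_equiv a b"
      "\<And>r. is_ray r \<Longrightarrow> end_equiv r a \<or> end_equiv r b"
    using two_ends_representatives[OF connected_graph_axioms assms(4)] unfolding ray iff by blast
  have few: "finite R" if "disjoint_rays R" for R
    using two_ended_no_infinite_disjoint_rays[OF ab that] .
  \<comment> \<open>A ray guarantees that there is an arc; vertex-transitivity carries its head and
    its tail to every vertex, giving in-neighbours and out-neighbours everywhere.\<close>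
  have "(a 0, a 1) \<in> ?E" using ab(1) by (auto simp: is_ray_def)
  then obtain s t where st: "(s, t) \<in> ?A" by (auto simp: E)
  then have stV: "s \<in> ?V" "t \<in> ?V" using A by auto
  have "\<exists>u. (u, v) \<in> ?A" if "v \<in> ?V" for v
    using vertex_transitive[OF assms(3) stV(2) that] automorphism_arc[OF wf _ st] by blast
  then obtain prev where prev: "\<And>v. v \<in> ?V \<Longrightarrow> (prev v, v) \<in> ?A" by metis
  have "\<exists>w. (v, w) \<in> ?A" if "v \<in> ?V" for v
    using vertex_transitive[OF assms(3) stV(1) that] automorphism_arc[OF wf _ st] by blast
  then obtain succ where succ: "\<And>v. v \<in> ?V \<Longrightarrow> (v, succ v) \<in> ?A" by metis
  have "\<exists>x. (\<forall>i. (x (Suc i), x i) \<in> ?A) \<and> (\<forall>v\<in>?V. \<exists>i. (x i, v) \<in> ?A\<^sup>*)"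
  proof (cases "acyclic ?A")
    case True
    interpret dag: vertex_transitive_dag ?V ?A
    proof unfold_locales
      show "\<exists>g h. g u = v \<and> (\<forall>x\<in>?V. h (g x) = x) \<and>
          (\<forall>x y. (x, y) \<in> ?A \<longrightarrow> (g x, g y) \<in> ?A) \<and> (\<forall>x y. (x, y) \<in> ?A \<longrightarrow> (h x, h y) \<in> ?A)"
        if uv: "u \<in> ?V" "v \<in> ?V" for u v
      proof -
        obtain g where g: "automorphism D g" "g u = v" using vertex_transitive[OF assms(3) uv] by blast
        have "\<forall>x\<in>?V. inv_into ?V g (g x) = x" using inv_left g(1) by blast
        then show ?thesis
          using g automorphism_arc[OF wf g(1)] automorphism_arc[OF wf automorphism_inv[OF g(1)]]
          by blast
      qed
      show "finite R" if R: "\<forall>r\<in>R. inj r \<and> (\<forall>i. (r (Suc i), r i) \<in> ?A)"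
          "pairwise (\<lambda>r s. disjnt (range r) (range s)) R" for R :: "(nat \<Rightarrow> 'a) set"
      \<comment> \<open>Backward rays are rays of the underlying undirected graph.\<close>
      proof (rule few)
        show "disjoint_rays R" unfolding disjoint_rays_def is_ray_def using R by (auto simp: E)
      qed
    qed (use A True stV prev conn in \<open>auto simp: E\<close>)
    show ?thesis using dag.backward_path_with_all_descendants unfolding dag.anc_def by blast
  next
    case False
    \<comment> \<open>With a directed cycle every vertex reaches every other, so any backward path
      will do.\<close>
    define x where "x i = (prev ^^ i) s" for i
    have V: "x i \<in> ?V" for i
    proof (induct i)
      case (Suc i)
      then show ?case using prev[OF Suc] A by (auto simp: x_def)
    qed (simp add: x_def stV)
    have "(x (Suc i), x i) \<in> ?A" for i using prev[OF V[of i]] by (simp add: x_def)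
    moreover have "(x 0, v) \<in> ?A\<^sup>*" if "v \<in> ?V" for v
      using cyclic_imp_reachable[OF wf assms(3) False] conn[OF V that] by (simp add: E)
    ultimately show ?thesis by blast
  qed
  then obtain x where x: "\<And>i. (x (Suc i), x i) \<in> ?A" "\<And>v. v \<in> ?V \<Longrightarrow> \<exists>i. (x i, v) \<in> ?A\<^sup>*" by blast
  \<comment> \<open>The forward half starts at \<open>x 0\<close>, so \<open>y 0 = x 0\<close> and
    the two halves agree at index 0 of \<open>L\<close>.\<close>
  define y where "y i = (succ ^^ i) (x 0)" for i
  have y_in: "y i \<in> ?V" for i
  proof (induct i)
    case 0
    then show ?case using x(1)[of 0] A by (auto simp: y_def)
  next
    case (Suc i)
    then show ?case using succ[OF Suc] A by (auto simp: y_def)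
  qed
  define L where "L i = (if 0 \<le> i then y (nat i) else x (nat (- i)))" for i :: int
  have "(L i, L (i + 1)) \<in> ?A" for i
  proof -
    consider "0 \<le> i" | "i = - 1" | "i < - 1" by linarith
    then show ?thesis
    proof cases
      case 1
      then have "nat (i + 1) = Suc (nat i)" by simp
      then show ?thesis using 1 succ[OF y_in[of "nat i"]] by (simp add: L_def y_def)
    next
      case 2
      then show ?thesis using x(1)[of 0] by (simp add: L_def y_def)
    next
      case 3
      then have "nat (- i) = Suc (nat (- (i + 1)))" by simp
      then show ?thesis using 3 x(1)[of "nat (- (i + 1))"] by (simp add: L_def)
    qed
  qed
  then have "directed_line D L" by (simp add: directed_line_def)
  moreover have "\<exists>i. v \<in> desc D (L i)" if v: "v \<in> ?V" for v
  proof -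
    obtain i where i: "(x i, v) \<in> ?A\<^sup>*" using x(2)[OF v] by blast
    have "x i \<in> ?V" using x(1)[of i] A by auto
    then have "(x i, v) \<in> rtrancl_on ?V ?A"
      using i v A by (intro rtrancl_consistent_rtrancl_on) auto
    then have "v \<in> desc D (x i)" by (rule reachable_imp_desc)
    moreover have "x i = L (- int i)" by (cases "i = 0") (simp_all add: L_def y_def)
    ultimately show ?thesis by metis
  qed
  ultimately show ?thesis using induce_desc_line_iff[OF wf] by blast
qed

end
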